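(* Let $N$ be a positive even integer, $h=2\pi/N$, and $\tau>0$. Let $D$ and $A$ be the linear operators on $N$-periodic complex grid functions $\mathbf{u}=(u_1,\dots,u_N)^T$ (with $u_{j+N}=u_j$) given by $$(D\mathbf{u})_j=\frac{u_{j+1}-2u_j+u_{j-1}}{h^2},\qquad (A\mathbf{u})_j=\frac{u_{j}-u_{j-1}}{h}.$$ Consider the fully discrete upwind scheme with ETD-RK1 time stepping $$\mathbf{u}^{n+1}=e^{\tau D}\mathbf{u}^n-D^{-1}\left(e^{\tau D}-I\right)A\mathbf{u}^n .$$ If $\tau\le \max\{2,h\}$, then the scheme is stable, with growth factor satisfying $|\widehat{G}(\tau,h,\omega)|\le 1$ for all $\omega\in\{-\frac N2+1,\dots,\frac N2\}$.
   Context: The scheme discretizes the dimensionless advection-diffusion equation $u_t+u_x=u_{xx}$ with periodic boundary condition on a uniform grid. Convention: $D^{-1}(e^{\tau D}-I)$ denotes $\tau\varphi_1(\tau D)$, where $\varphi_1(z)=(e^z-1)/z$ is the entire function with $\varphi_1(0)=1$. Thus if $D\mathbf v=\lambda\mathbf v$, then $D^{-1}(e^{\tau D}-I)\mathbf v=\lambda^{-1}(e^{\tau\lambda}-1)\mathbf v$, read as $\tau\mathbf v$ when $\lambda=0$. Growth factor: for an integer $\omega\in\{-\frac N2+1,\dots,\frac N2\}$ the Fourier mode $u_j^n=\widehat u^n e^{\mathrm i\omega jh}$, $j=1,\dots,N$, is a common eigenvector of $D$ and $A$, and the scheme maps it to $\mathbf u^{n+1}=\widehat G(\tau,h,\omega)\mathbf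 u^n$; the scalar $\widehat G(\tau,h,\omega)$ is the growth factor, explicitly $$\widehat{G}(\tau,h,\omega)=e^{-\frac{4\tau}{h^2}\sin^2(\frac{\omega h}{2})}+\frac h2\left(e^{-\frac{4\tau}{h^2}\sin^2(\frac{\omega h}{2})}-1\right)+\mathrm i\frac{h}{2}\cot\left(\frac{\omega h}{2}\right)\left(e^{-\frac{4\tau}{h^2}\sin^2(\frac{\omega h}{2})}-1\right),$$ read as its limit $1$ at $\omega=0$. Stability means $|\widehat G(\tau,h,\omega)|\le1$ for all such $\omega$. *)

theory Defs
  imports "HOL-Complex_Analysis.Complex_Analysis"
begin

section \<open>Periodic grid functions and difference operators\<close>

text \<open>
  A vector \<open>(u\<^sub>1, \<dots>, u\<^sub>N)\<close> extended by \<open>u\<^sub>j\<^sub>+\<^sub>N = u\<^sub>j\<close> is an \<open>N\<close>-periodic function on the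
  integers.  The operators below are given by formulas that make sense on all functions
  \<open>int \<Rightarrow> complex\<close>; \<open>etd_upwind_step_periodic\<close> shows that the scheme restricts to the
  periodic ones.
\<close>

definition periodic_grid :: "nat \<Rightarrow> (int \<Rightarrow> complex) set" where
  "periodic_grid N = {u. \<forall>j. u (j + int N) = u j}"

definition diffusion_op :: "real \<Rightarrow> (int \<Rightarrow> complex) \<Rightarrow> (int \<Rightarrow> complex)" where
  "diffusion_op h u = (\<lambda>j. (u (j + 1) - 2 * u j + u (j - 1)) / of_real (h\<^sup>2))"

definition upwind_op :: "real \<Rightarrow> (int \<Rightarrow> complex) \<Rightarrow> (int \<Rightarrow> complex)" where
  "upwind_op h u = (\<lambda>j. (u j - u (j - 1)) / of_real h)"


section \<open>Entire functions of an operator\<close>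

text \<open>
  \<open>f(L) = \<Sum>k. f\<^sup>(\<^sup>k\<^sup>)(0)/k! L\<^sup>k\<close>, evaluated pointwise.  On \<open>N\<close>-periodic functions, a space of finite
  dimension, this is the usual function of a matrix; convergence for the operators used
  here is \<open>summable_entire_op\<close>.
\<close>

definition entire_op ::
  "(complex \<Rightarrow> complex) \<Rightarrow> ((int \<Rightarrow> complex) \<Rightarrow> (int \<Rightarrow> complex)) \<Rightarrow> (int \<Rightarrow> complex) \<Rightarrow> (int \<Rightarrow> complex)"
  where "entire_op f L u = (\<lambda>j. \<Sum>k. fps_nth (fps_expansion f 0) k * (L ^^ k) u j)"

definition phi1 :: "complex \<Rightarrow> complex" where
  "phi1 z = (if z = 0 then 1 else (exp z - 1) / z)"

definition scaled_diffusion_op :: "real \<Rightarrow> real \<Rightarrow> (int \<Rightarrow> complex) \<Rightarrow> (int \<Rightarrow> complex)" where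
  "scaled_diffusion_op \<tau> h u = (\<lambda>j. of_real \<tau> * diffusion_op h u j)"

text \<open>
  The diffusion operator is singular (constants are in its kernel), so
  \<open>D\<^sup>-\<^sup>1(e\<^sup>\<tau>\<^sup>D - I)\<close> is read as \<open>\<tau> \<phi>\<^sub>1(\<tau>D)\<close>.
\<close>

definition etd_upwind_step :: "real \<Rightarrow> real \<Rightarrow> (int \<Rightarrow> complex) \<Rightarrow> (int \<Rightarrow> complex)" where
  "etd_upwind_step \<tau> h u =
     (\<lambda>j. entire_op exp (scaled_diffusion_op \<tau> h) u j
          - of_real \<tau> * entire_op phi1 (scaled_diffusion_op \<tau> h) (upwind_op h u) j)"


section \<open>Fourier modes, growth factors, stability\<close>

definition fourier_mode :: "real \<Rightarrow> int \<Rightarrow> int \<Rightarrow> complex" where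
  "fourier_mode h \<omega> = (\<lambda>j. exp (\<i> * of_real (of_int \<omega> * of_int j * h)))"

text \<open>Since modes do not vanish, a mode has at most one growth factor.\<close>

definition is_growth_factor ::
  "((int \<Rightarrow> complex) \<Rightarrow> (int \<Rightarrow> complex)) \<Rightarrow> real \<Rightarrow> int \<Rightarrow> complex \<Rightarrow> bool" where
  "is_growth_factor S h \<omega> g \<longleftrightarrow>
     (\<forall>a. S (\<lambda>j. a * fourier_mode h \<omega> j) = (\<lambda>j. g * (a * fourier_mode h \<omega> j)))"

definition frequencies :: "nat \<Rightarrow> int set" where
  "frequencies N = {- (int N div 2) + 1 .. int N div 2}"

definition fourier_stable ::
  "nat \<Rightarrow> real \<Rightarrow> ((int \<Rightarrow> complex) \<Rightarrow> (int \<Rightarrow> complex)) \<Rightarrow> bool" where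
  "fourier_stable N h S \<longleftrightarrow>
     (\<forall>\<omega>\<in>frequencies N. \<exists>g. is_growth_factor S h \<omega> g \<and> cmod g \<le> 1)"

definition growth_factor :: "real \<Rightarrow> real \<Rightarrow> int \<Rightarrow> complex" where
  "growth_factor \<tau> h \<omega> =
     (if \<omega> = 0 then 1
      else let E = exp (- (4 * \<tau> / h\<^sup>2) * (sin (of_int \<omega> * h / 2))\<^sup>2)
           in of_real E + of_real (h / 2 * (E - 1))
              + \<i> * of_real (h / 2 * cot (of_int \<omega> * h / 2) * (E - 1)))"


section \<open>Well-definedness\<close>

lemma is_growth_factor_unique:
  assumes "is_growth_factor S h \<omega> g" "is_growth_factor S h \<omega> g'"
  shows "g = g'"
proof -
  have "(\<lambda>j. g * (1 * fourier_mode h \<omega> j)) = (\<lambda>j. g' * (1 * fourier_mode h \<omega> j))"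
    using assms unfolding is_growth_factor_def by metis
  from fun_cong[OF this, of 0] show ?thesis by (simp add: fourier_mode_def)
qed

lemma fourier_mode_periodic:
  assumes "N > 0" "h = 2 * pi / real N"
  shows "fourier_mode h \<omega> \<in> periodic_grid N"
proof -
  have "exp (\<i> * of_real (of_int \<omega> * of_int (j + int N) * h)) =
        exp (\<i> * of_real (of_int \<omega> * of_int j * h))" for j
  proof -
    have "of_int \<omega> * of_int (j + int N) * h = of_int \<omega> * of_int j * h + 2 * real_of_int \<omega> * pi"
      using assms by (simp add: field_simps)
    from arg_cong[OF this, of complex_of_real]
    have "\<i> * of_real (of_int \<omega> * of_int (j + int N) * h) =
           \<i> * of_real (of_int \<omega> * of_int j * h) + of_real (2 * real_of_int \<omega> * pi) * \<i>"
      unfolding of_real_add by (simp only: distrib_left mult.commute)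
    thus ?thesis by (auto simp: exp_eq intro!: exI[of _ \<omega>])
  qed
  thus ?thesis by (simp add: fourier_mode_def periodic_grid_def)
qed

lemma diffusion_op_periodic:
  "u \<in> periodic_grid N \<Longrightarrow> diffusion_op h u \<in> periodic_grid N"
proof -
  assume "u \<in> periodic_grid N"
  hence "u (k + int N) = u k" for k by (auto simp: periodic_grid_def)
  hence "u (j + int N + 1) = u (j + 1)" "u (j + int N - 1) = u (j - 1)" "u (j + int N) = u j" for j
    by (metis add.commute add.left_commute, metis diff_add_eq, simp)
  thus ?thesis by (simp add: diffusion_op_def periodic_grid_def)
qed

lemma upwind_op_periodic:
  "u \<in> periodic_grid N \<Longrightarrow> upwind_op h u \<in> periodic_grid N"
proof -
  assume "u \<in> periodic_grid N"
  hence "u (k + int N) = u k" for k by (auto simp: periodic_grid_def)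
  hence "u (j + int N - 1) = u (j - 1)" "u (j + int N) = u j" for j
    by (metis diff_add_eq, simp)
  thus ?thesis by (simp add: upwind_op_def periodic_grid_def)
qed

lemma scaled_diffusion_op_periodic:
  "u \<in> periodic_grid N \<Longrightarrow> scaled_diffusion_op \<tau> h u \<in> periodic_grid N"
  using diffusion_op_periodic[of u N h]
  by (auto simp: scaled_diffusion_op_def periodic_grid_def)

lemma scaled_diffusion_op_funpow_periodic:
  "u \<in> periodic_grid N \<Longrightarrow> (scaled_diffusion_op \<tau> h ^^ k) u \<in> periodic_grid N"
  by (induction k) (auto intro: scaled_diffusion_op_periodic)

lemma entire_op_periodic:
  assumes "u \<in> periodic_grid N"
  shows "entire_op f (scaled_diffusion_op \<tau> h) u \<in> periodic_grid N"
  using scaled_diffusion_op_funpow_periodic[OF assms, where \<tau> = \<tau> and h = h]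
  by (simp add: entire_op_def periodic_grid_def)

lemma etd_upwind_step_periodic:
  assumes "u \<in> periodic_grid N"
  shows "etd_upwind_step \<tau> h u \<in> periodic_grid N"
  using entire_op_periodic[OF assms] entire_op_periodic[OF upwind_op_periodic[OF assms]]
  by (simp add: etd_upwind_step_def periodic_grid_def)

lemma phi1_entire: "phi1 holomorphic_on UNIV"
proof -
  have "(exp has_field_derivative 1) (at (0::complex))"
    using DERIV_exp[of "0::complex"] by simp
  hence "(\<lambda>z::complex. (exp z - 1) / z) \<midarrow>0\<rightarrow> 1"
    by (simp add: has_field_derivative_iff)
  hence "(\<lambda>z. if z = 0 then 1 else (exp z - 1) / z) holomorphic_on (UNIV :: complex set)"
    by (intro removable_singularity holomorphic_intros) auto
  thus ?thesis by (simp add: phi1_def[abs_def])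
qed

lemma periodic_grid_bounded:
  assumes "N > 0" "u \<in> periodic_grid N"
  obtains M where "\<And>j. cmod (u j) \<le> M"
proof -
  have per: "u (j + int N) = u j" for j using assms by (simp add: periodic_grid_def)
  have up: "u (j + int n * int N) = u j" for j n
  proof (induction n)
    case (Suc n)
    have "u (j + int (Suc n) * int N) = u (j + int n * int N + int N)"
      by (simp add: algebra_simps)
    thus ?case using per Suc by simp
  qed simp
  have full: "u (j + k * int N) = u j" for j k
  proof (cases "k \<ge> 0")
    case True
    thus ?thesis using up[of j "nat k"] by simp
  next
    case False
    thus ?thesis using up[of "j + k * int N" "nat (-k)"] by (simp add: algebra_simps)
  qed
  have "u j = u (j mod int N)" for j
    using full[of "j mod int N" "j div int N"] by (metis add.commute div_mult_mod_eq)
  moreover have "j mod int N \<in> {0..<int N}" for j using assms by simp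
  ultimately have "cmod (u j) \<le> Max ((\<lambda>j. cmod (u j)) ` {0..<int N})" for j
    by (metis (no_types, lifting) Max_ge finite_atLeastLessThan_int finite_imageI imageI)
  thus thesis using that by blast
qed

lemma summable_entire_op:
  assumes f: "f holomorphic_on UNIV" and "N > 0" "u \<in> periodic_grid N"
  shows "summable (\<lambda>k. fps_nth (fps_expansion f 0) k * (scaled_diffusion_op \<tau> h ^^ k) u j)"
proof -
  obtain M where M: "\<And>j. cmod (u j) \<le> M" using periodic_grid_bounded assms by metis
  define c where "c = \<bar>\<tau>\<bar> * (4 / h\<^sup>2)"
  have c0: "c \<ge> 0" by (simp add: c_def)
  have bd: "cmod ((scaled_diffusion_op \<tau> h ^^ k) u j) \<le> c ^ k * M" for k j
  proof (induction k arbitrary: j)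
    case (Suc k)
    define v where "v = (scaled_diffusion_op \<tau> h ^^ k) u"
    have v: "cmod (v i) \<le> c ^ k * M" for i using Suc by (simp add: v_def)
    have "cmod (v (j + 1) - 2 * v j + v (j - 1)) \<le> cmod (v (j + 1)) + 2 * cmod (v j) + cmod (v (j - 1))"
      using norm_triangle_ineq[of "v (j + 1) - 2 * v j" "v (j - 1)"]
        norm_triangle_ineq4[of "v (j + 1)" "2 * v j"] by (simp add: norm_mult)
    also have "\<dots> \<le> 4 * (c ^ k * M)" using v[of "j+1"] v[of j] v[of "j-1"] by simp
    finally have "cmod (scaled_diffusion_op \<tau> h v j) \<le> \<bar>\<tau>\<bar> * (4 * (c ^ k * M) / h\<^sup>2)"
      unfolding scaled_diffusion_op_def diffusion_op_def
      by (auto simp: norm_mult norm_divide norm_power intro!: mult_left_mono divide_right_mono)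
    thus ?case by (simp add: v_def c_def mult_ac)
  qed (use M in auto)
  have "fps_conv_radius (fps_expansion f 0) \<ge> \<infinity>"
    using f by (intro conv_radius_fps_expansion) (auto intro: holomorphic_on_subset)
  hence "summable (\<lambda>k. norm (fps_nth (fps_expansion f 0) k * of_real c ^ k))"
    by (intro abs_summable_in_conv_radius) (simp add: fps_conv_radius_def)
  hence "summable (\<lambda>k. cmod (fps_nth (fps_expansion f 0) k) * c ^ k * M)"
    using c0 by (intro summable_mult2) (simp add: norm_mult norm_power)
  thus ?thesis
    by (rule summable_comparison_test'[where N = 0])
       (auto simp: norm_mult mult.assoc intro!: mult_left_mono bd)
qed

text \<open>Spectral characterization: \<open>f(\<tau>D)v = f(\<tau>\<lambda>)v\<close> whenever \<open>Dv = \<lambda>v\<close>.\<close>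

lemma entire_op_eigenvector:
  assumes f: "f holomorphic_on UNIV" and "\<And>j. diffusion_op h v j = \<mu> * v j"
  shows "entire_op f (scaled_diffusion_op \<tau> h) v j = f (of_real \<tau> * \<mu>) * v j"
proof -
  let ?L = "scaled_diffusion_op \<tau> h" and ?z = "of_real \<tau> * \<mu> :: complex"
  have hom: "?L (\<lambda>i. a * v i) = (\<lambda>i. ?z * a * v i)" for a
  proof
    fix i
    have "?L (\<lambda>i. a * v i) i = of_real \<tau> * a * diffusion_op h v i"
      by (simp add: scaled_diffusion_op_def diffusion_op_def algebra_simps diff_divide_distrib add_divide_distrib)
    thus "?L (\<lambda>i. a * v i) i = ?z * a * v i" using assms(2) by simp
  qed
  have pow: "(?L ^^ k) v = (\<lambda>i. ?z ^ k * v i)" for k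
    by (induction k) (simp_all add: hom)
  have r: "fps_conv_radius (fps_expansion f 0) \<ge> \<infinity>"
    using f by (intro conv_radius_fps_expansion) (auto intro: holomorphic_on_subset)
  hence "summable (\<lambda>k. fps_nth (fps_expansion f 0) k * ?z ^ k)"
    by (intro summable_in_conv_radius) (simp add: fps_conv_radius_def)
  hence "entire_op f ?L v j = (\<Sum>k. fps_nth (fps_expansion f 0) k * ?z ^ k) * v j"
    by (simp add: entire_op_def pow suminf_mult2 mult.assoc)
  also have "(\<Sum>k. fps_nth (fps_expansion f 0) k * ?z ^ k) = eval_fps (fps_expansion f 0) ?z"
    by (simp add: eval_fps_def)
  also have "\<dots> = f ?z"
    using eval_fps_expansion[of f 0 \<infinity> "?z"] f by (auto intro: holomorphic_on_subset)
  finally show ?thesis .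
qed

end

theory Submission
  imports Defs
begin

text \<open>
  Put \<open>s = sin(\<omega>h/2)\<close>, \<open>y = 4s\<^sup>2/h\<^sup>2\<close> and \<open>E = exp(-\<tau>y)\<close>.  Since \<open>cot\<^sup>2 = 1/s\<^sup>2 - 1\<close>, the condition
  \<open>|G| \<le> 1\<close> reads \<open>(1 - E)(1 + h + 1/y) \<le> 2 + h\<close>.  For \<open>\<tau> \<le> 2\<close> the terms in \<open>h\<close> drop out because
  \<open>E > 0\<close>, and \<open>(1 - exp(-2y))(1 + y) \<le> 2y\<close> is the inequality \<open>tanh y \<le> y\<close>.  The alternative
  \<open>2 < \<tau> \<le> h\<close> forces \<open>N = 2\<close>, whose only nonzero frequency has \<open>s = 1\<close> and cotangent \<open>0\<close>; the
  condition becomes \<open>E \<ge> (h - 2)/(h + 2)\<close>, which is \<open>tanh z \<le> z\<close> at \<open>z = 2/h\<close>.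
\<close>

text \<open>This is \<open>tanh y \<le> y\<close> cleared of denominators. The difference of the two
  sides vanishes at 0 and has derivative \<open>1 - (1 + 2 * x) * exp (- 2 * x)\<close>, nonnegative
  because \<open>exp (2 * x) \<ge> 1 + 2 * x\<close>.\<close>

lemma one_minus_le_exp_neg_double:
  fixes y :: real
  assumes "y \<ge> 0"
  shows "1 - y \<le> (1 + y) * exp (- 2 * y)"
proof -
  have "(\<lambda>y. (1 + y) * exp (- 2 * y) - (1 - y)) 0 \<le> (\<lambda>y::real. (1 + y) * exp (- 2 * y) - (1 - y)) y"
  proof (rule DERIV_nonneg_imp_nondecreasing[OF assms])
    fix x :: real
    assume "0 \<le> x"
    have "(1 + 2 * x) * exp (- 2 * x) \<le> exp (2 * x) * exp (- 2 * x)"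
      using exp_ge_add_one_self[of "2 * x"] by (intro mult_right_mono) auto
    then have "(1 + 2 * x) * exp (- 2 * x) \<le> 1"
      by (simp flip: exp_add)
    then show "\<exists>d. ((\<lambda>y. (1 + y) * exp (- 2 * y) - (1 - y)) has_real_derivative d) (at x) \<and> 0 \<le> d"
      by (intro exI[of _ "1 - (1 + 2 * x) * exp (- 2 * x)"] conjI)
         (auto intro!: derivative_eq_intros simp: algebra_simps)
  qed
  then show ?thesis by simp
qed

text \<open>Translations act on a mode by scalars, which makes every mode an eigenvector of both
  difference operators.\<close>

lemma fourier_mode_shift:
  "fourier_mode h \<omega> (j + k) = cis (of_int \<omega> * of_int k * h) * fourier_mode h \<omega> j"
  by (simp add: fourier_mode_def cis_conv_exp algebra_simps flip: exp_add)

lemma diffusion_op_fourier_mode: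
  "diffusion_op h (\<lambda>j. a * fourier_mode h \<omega> j) j
     = of_real (- (4 / h\<^sup>2) * (sin (of_int \<omega> * h / 2))\<^sup>2) * (a * fourier_mode h \<omega> j)"
proof -
  define t where "t = of_int \<omega> * h / 2"
  have t: "of_int \<omega> * h = 2 * t"
    by (simp add: t_def)
  have "cis (2 * t) - 2 + cis (- (2 * t)) = of_real (- 4 * (sin t)\<^sup>2)"
    by (simp add: complex_eq_iff cos_double_sin)
  \<comment> \<open>The backward neighbour is written \<open>j + - 1\<close> so that the shift rule
    applies with \<open>k = - 1\<close>.\<close>
  then have "a * (fourier_mode h \<omega> (j + 1) - 2 * fourier_mode h \<omega> j + fourier_mode h \<omega> (j + - 1))
      = of_real (- 4 * (sin t)\<^sup>2) * (a * fourier_mode h \<omega> j)"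
    unfolding fourier_mode_shift by (simp add: t) algebra
  then show ?thesis
    by (simp add: diffusion_op_def t_def right_diff_distrib distrib_left mult.left_commute)
qed

lemma upwind_op_fourier_mode:
  "upwind_op h (\<lambda>j. a * fourier_mode h \<omega> j)
     = (\<lambda>j. ((1 - cis (- (of_int \<omega> * h))) / of_real h * a) * fourier_mode h \<omega> j)"
  using fourier_mode_shift[of h \<omega> _ "-1"]
  by (intro ext) (simp add: upwind_op_def field_simps diff_divide_distrib)

text \<open>In half-angle form both parts carry a factor \<open>sin t\<close>; dividing by the
  diffusion eigenvalue, a multiple of \<open>(sin t)\<^sup>2\<close>, then leaves a constant and a
  cotangent.\<close>

lemma one_minus_cis_neg_double:
  "1 - cis (- (2 * t)) = of_real (2 * (sin t)\<^sup>2) + \<i> * of_real (2 * sin t * cos t)"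
  by (simp add: complex_eq_iff cos_double_sin sin_double)

text \<open>On a mode the diffusion operator acts as \<open>\<mu>\<close> and the upwind operator as
  \<open>\<alpha>\<close>, so the step multiplies by the scalar on the left of
  \<open>G\<close>.\<close>

lemma is_growth_factor_etd_upwind_step:
  assumes "h \<noteq> 0" "\<tau> \<noteq> 0"
  shows "is_growth_factor (etd_upwind_step \<tau> h) h \<omega> (growth_factor \<tau> h \<omega>)"
proof -
  define t where "t = of_int \<omega> * h / 2"
  define \<mu> where "\<mu> = - (4 / h\<^sup>2) * (sin t)\<^sup>2"
  define \<alpha> where "\<alpha> = (1 - cis (- (of_int \<omega> * h))) / of_real h"
  define E where "E = exp (\<tau> * \<mu>)"
  have D: "diffusion_op h (\<lambda>j. a * fourier_mode h \<omega> j) j = of_real \<mu> * (a * fourier_mode h \<omega> j)" for a j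
    unfolding \<mu>_def t_def by (rule diffusion_op_fourier_mode)
  have \<alpha>: "\<alpha> = (of_real (2 * (sin t)\<^sup>2) + \<i> * of_real (2 * sin t * cos t)) / of_real h"
    using one_minus_cis_neg_double[of t] by (simp add: \<alpha>_def t_def)
  have G: "exp (of_real \<tau> * of_real \<mu>) - of_real \<tau> * (phi1 (of_real \<tau> * of_real \<mu>) * \<alpha>)
             = growth_factor \<tau> h \<omega>"
  proof (cases "sin t = 0")
    \<comment> \<open>Here \<open>\<mu>\<close> and \<open>\<alpha>\<close> both vanish, so the
      scalar is 1. The closed formula also gives 1, even for \<open>\<omega> \<noteq> 0\<close>,
      since its exponential is 1 and the cotangent is multiplied by 0.\<close>
    case True
    then show ?thesis
      by (simp add: \<alpha> \<mu>_def growth_factor_def t_def)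
  next
    case False
    then have "\<omega> \<noteq> 0" by (auto simp: t_def)
    have "\<mu> \<noteq> 0" using False assms by (simp add: \<mu>_def)
    have E: "exp (of_real \<tau> * of_real \<mu> :: complex) = of_real E"
      unfolding E_def exp_of_real[symmetric] by simp
    have g: "growth_factor \<tau> h \<omega>
        = of_real E + of_real (h / 2 * (E - 1)) + \<i> * of_real (h / 2 * cot t * (E - 1))"
      using \<open>\<omega> \<noteq> 0\<close> by (simp add: growth_factor_def Let_def t_def E_def \<mu>_def mult_ac)
    have "of_real \<tau> * (phi1 (of_real \<tau> * of_real \<mu>) * \<alpha>) = of_real ((E - 1) / \<mu>) * \<alpha>"
      using \<open>\<mu> \<noteq> 0\<close> assms by (simp add: phi1_def E)
    \<comment> \<open>The quotient \<open>\<alpha> / \<mu>\<close> equals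
      \<open>- h / 2 * (1 + \<i> * cot t)\<close>.\<close>
    also have "\<dots> = - of_real (h / 2 * (E - 1)) - \<i> * of_real (h / 2 * cot t * (E - 1))"
      using False assms
      by (simp add: \<alpha> \<mu>_def cot_def complex_eq_iff field_simps power2_eq_square)
    finally show ?thesis by (simp add: g E)
  qed
  show ?thesis
    unfolding is_growth_factor_def
  proof (intro allI ext)
    fix a j
    let ?v = "\<lambda>j. a * fourier_mode h \<omega> j" and ?w = "\<lambda>j. (\<alpha> * a) * fourier_mode h \<omega> j"
    have "upwind_op h ?v = ?w"
      unfolding \<alpha>_def by (rule upwind_op_fourier_mode)
    then have "etd_upwind_step \<tau> h ?v j
        = exp (of_real \<tau> * of_real \<mu>) * ?v j - of_real \<tau> * (phi1 (of_real \<tau> * of_real \<mu>) * ?w j)"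
      using entire_op_eigenvector[OF holomorphic_on_exp D]
        entire_op_eigenvector[OF phi1_entire D]
      by (simp add: etd_upwind_step_def)
    also have "\<dots> = growth_factor \<tau> h \<omega> * ?v j"
      unfolding G[symmetric] by (simp add: algebra_simps)
    finally show "etd_upwind_step \<tau> h ?v j = growth_factor \<tau> h \<omega> * ?v j" .
  qed
qed

text \<open>The squared modulus minus 1 is quadratic in \<open>x = 1 - exp (- (\<tau> * y))\<close>
  without constant term, so the positive factor \<open>x\<close> can be cancelled.\<close>

lemma cmod_growth_factor_le_1_iff:
  fixes \<tau> h :: real and \<omega> :: int
  defines "s \<equiv> sin (of_int \<omega> * h / 2)"
  defines "y \<equiv> 4 * s\<^sup>2 / h\<^sup>2"
  assumes "h > 0" "\<tau> > 0" "s \<noteq> 0"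
  shows "cmod (growth_factor \<tau> h \<omega>) \<le> 1 \<longleftrightarrow> (1 - exp (- (\<tau> * y))) * (1 + h + 1 / y) \<le> 2 + h"
proof -
  define x where "x = 1 - exp (- (\<tau> * y))"
  define c where "c = cot (of_int \<omega> * h / 2)"
  have "y > 0" using assms by (simp add: y_def)
  have "x > 0" using \<open>y > 0\<close> assms by (simp add: x_def)
  have c2: "c\<^sup>2 = 1 / s\<^sup>2 - 1"
    using \<open>s \<noteq> 0\<close> by (simp add: c_def s_def cot_def power_divide cos_squared_eq field_simps)
  \<comment> \<open>The term \<open>- h\<^sup>2 / 4\<close> will cancel the square of
    \<open>h / 2\<close> coming from the real part.\<close>
  have c: "(h / 2 * c)\<^sup>2 = 1 / y - h\<^sup>2 / 4"
    by (simp add: y_def power_mult_distrib power_divide c2 right_diff_distrib diff_divide_distrib)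
  have "\<omega> \<noteq> 0" using \<open>s \<noteq> 0\<close> by (auto simp: s_def)
  have E: "exp (- (4 * \<tau> / h\<^sup>2) * s\<^sup>2) = 1 - x"
    by (simp add: x_def y_def field_simps)
  have g: "growth_factor \<tau> h \<omega> = Complex (1 - x - h / 2 * x) (- (h / 2 * c * x))"
    using \<open>\<omega> \<noteq> 0\<close> E by (simp add: growth_factor_def Let_def s_def c_def complex_eq_iff)
  have "(cmod (growth_factor \<tau> h \<omega>))\<^sup>2 = (1 - x - h / 2 * x)\<^sup>2 + (h / 2 * c)\<^sup>2 * x\<^sup>2"
    unfolding cmod_power2 by (simp add: g power2_eq_square)
  also have "\<dots> = 1 + x * (x * (1 + h + 1 / y) - (2 + h))"
    unfolding c by (simp add: algebra_simps power2_eq_square)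
  finally have sq: "(cmod (growth_factor \<tau> h \<omega>))\<^sup>2 = 1 + x * (x * (1 + h + 1 / y) - (2 + h))" .
  have "cmod (growth_factor \<tau> h \<omega>) \<le> 1 \<longleftrightarrow> (cmod (growth_factor \<tau> h \<omega>))\<^sup>2 \<le> 1"
    by (simp add: power_le_one_iff)
  also have "\<dots> \<longleftrightarrow> x * (1 + h + 1 / y) \<le> 2 + h"
    unfolding sq using \<open>x > 0\<close> by (simp add: mult_le_0_iff)
  finally show ?thesis unfolding x_def .
qed

lemma cmod_growth_factor_le_1:
  assumes "N > 0" "even N" and h: "h = 2 * pi / real N" and "\<tau> > 0" "\<tau> \<le> max 2 h"
    and \<omega>: "\<omega> \<in> frequencies N"
  shows "cmod (growth_factor \<tau> h \<omega>) \<le> 1"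
proof (cases "\<omega> = 0")
  case True
  then show ?thesis by (simp add: growth_factor_def)
next
  case False
  define s where "s = sin (of_int \<omega> * h / 2)"
  define y where "y = 4 * s\<^sup>2 / h\<^sup>2"
  define E where "E = exp (- (\<tau> * y))"
  have "h > 0" using \<open>N > 0\<close> h by simp
  have "\<bar>\<omega>\<bar> < int N" using \<omega> \<open>N > 0\<close> by (auto simp: frequencies_def)
  have arg: "of_int \<omega> * h / 2 = pi * (of_int \<omega> / real N)" by (simp add: h)
  \<comment> \<open>A zero of the sine would make \<open>N\<close> divide \<open>\<omega>\<close>,
    impossible for \<open>0 < \<bar>\<omega>\<bar> < N\<close>.\<close>
  have "s \<noteq> 0"
  proof
    assume "s = 0"
    then obtain k :: int where "pi * (of_int \<omega> / real N) = of_int k * pi"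
      unfolding s_def arg sin_zero_iff_int2 by blast
    then have "real_of_int \<omega> = of_int (k * int N)"
      using \<open>N > 0\<close> by (simp add: field_simps)
    then have "int N dvd \<omega>" by (metis dvd_triv_right of_int_eq_iff)
    then show False using \<open>\<bar>\<omega>\<bar> < int N\<close> False zdvd_not_zless[of "\<bar>\<omega>\<bar>" "int N"] by simp
  qed
  then have "y > 0" using \<open>h > 0\<close> by (simp add: y_def)
  have "(1 - E) * (1 + h + 1 / y) \<le> 2 + h"
  proof (cases "\<tau> \<le> 2")
    case True
    have "exp (- 2 * y) \<le> E"
      using True \<open>y > 0\<close> by (simp add: E_def)
    then have "(1 + y) * exp (- 2 * y) \<le> (1 + y) * E"
      using \<open>y > 0\<close> by (intro mult_left_mono) auto
    then have "1 - y \<le> (1 + y) * E"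
      using one_minus_le_exp_neg_double[of y] \<open>y > 0\<close> by (meson less_imp_le order_trans)
    then have "(1 - E) * (1 + 1 / y) \<le> 2"
      using \<open>y > 0\<close> by (simp add: field_simps)
    moreover have "(1 - E) * h \<le> h"
      using \<open>h > 0\<close> by (simp add: E_def algebra_simps)
    ultimately show ?thesis by (simp add: algebra_simps)
  next
    case False
    then have "\<tau> \<le> h" "2 < h" using \<open>\<tau> \<le> max 2 h\<close> by auto
    then have "real N < pi" using \<open>N > 0\<close> by (simp add: h field_simps)
    then have "N < 4" using pi_less_4 by simp
    then have "N = 2" using \<open>N > 0\<close> \<open>even N\<close> by (elim evenE) simp
    then have "\<omega> = 1" using \<omega> \<open>\<omega> \<noteq> 0\<close> by (auto simp: frequencies_def)
    then have y: "y = 4 / h\<^sup>2" unfolding y_def s_def arg using \<open>N = 2\<close> by simp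
    \<comment> \<open>The bound \<open>\<tau> \<le> h\<close> gives
      \<open>\<tau> * y \<le> 4 / h\<close>, which is \<open>2 * z\<close> for
      \<open>z = 2 / h\<close>.\<close>
    have "\<tau> * y \<le> h * y" using \<open>\<tau> \<le> h\<close> \<open>y > 0\<close> by simp
    also have "\<dots> = 2 * (2 / h)" using \<open>h > 0\<close> by (simp add: y power2_eq_square)
    finally have "exp (- 2 * (2 / h)) \<le> E" by (simp add: E_def)
    then have "(1 + 2 / h) * exp (- 2 * (2 / h)) \<le> (1 + 2 / h) * E"
      using \<open>h > 0\<close> by (intro mult_left_mono) auto
    then have "1 - 2 / h \<le> (1 + 2 / h) * E"
      using one_minus_le_exp_neg_double[of "2 / h"] \<open>h > 0\<close> by simp
    then have "h * (1 - 2 / h) \<le> h * ((1 + 2 / h) * E)"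
      using \<open>h > 0\<close> by (intro mult_left_mono) auto
    then have "(1 - E) * (h + 2) \<le> 4"
      using \<open>h > 0\<close> by (simp add: algebra_simps)
    \<comment> \<open>Since \<open>1 / y = h\<^sup>2 / 4\<close>, the factor
      \<open>1 + h + 1 / y\<close> in the goal is \<open>(h + 2)\<^sup>2 / 4\<close>; hence the
      second factor \<open>h + 2\<close>.\<close>
    then have "(1 - E) * (h + 2) * (h + 2) \<le> 4 * (h + 2)"
      using \<open>h > 0\<close> by (intro mult_right_mono) auto
    then show ?thesis by (simp add: y field_simps power2_eq_square)
  qed
  then show ?thesis
    using cmod_growth_factor_le_1_iff[of h \<tau> \<omega>] \<open>h > 0\<close> \<open>\<tau> > 0\<close> \<open>s \<noteq> 0\<close>
    by (simp add: E_def y_def s_def)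
qed

theorem theorem3p2:
  fixes N :: nat and h \<tau> :: real
  assumes "N > 0" and "even N"
    and "h = 2 * pi / real N"
    and "\<tau> > 0"
    and "\<tau> \<le> max 2 h"
  shows "fourier_stable N h (etd_upwind_step \<tau> h) \<and>
    (\<forall>\<omega>\<in>frequencies N.
       is_growth_factor (etd_upwind_step \<tau> h) h \<omega> (growth_factor \<tau> h \<omega>) \<and>
       cmod (growth_factor \<tau> h \<omega>) \<le> 1)"
proof -
  have "h \<noteq> 0" "\<tau> \<noteq> 0" using assms by auto
  then show ?thesis
    unfolding fourier_stable_def
    using is_growth_factor_etd_upwind_step cmod_growth_factor_le_1[OF assms] by blast
qed

end
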